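(* Let $a,b$ be positive integers and let $(M_n,g,J)$ be a metallic Riemannian manifold, with associated projectors $l,m$, complementary distributions $L,M$ and associated almost product structure $F$. Then the following hold. (a) The projectors $l,m$ are $g$-symmetric: $g(l(X),Y)=g(X,l(Y))$ and $g(m(X),Y)=g(X,m(Y))$ for all $X,Y\in\chi(M_n)$. (b) The distributions $L,M$ are $g$-orthogonal: $g(l(X),m(Y))=0$ for all $X,Y\in\chi(M_n)$. (c) The metallic structure is $N_J$-symmetric: $N_J(J(X),Y)=N_J(X,J(Y))$ for all $X,Y\in\chi(M_n)$. Moreover, if $\nabla$ is a symmetric linear connection on $M_n$, then $$N_F(X,Y)=(\nabla_{FX}F)Y-(\nabla_{FY}F)X-F(\nabla_XF)Y+F(\nabla_YF)X$$ for all $X,Y\in\chi(M_n)$; and if $(M_n,g,J)$ is a locally product metallic Riemannian manifold, then the metallic structure $J$ is integrable.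
   Context: All manifolds and tensor fields are $C^\infty$; $\chi(M_n)$ is the Lie algebra of vector fields on $M_n$ and $I$ is the identity. A metallic structure is a $(1,1)$-tensor field $J$ with $J^2=aJ+bI$, and $\rho_{a,b}=\frac{a+\sqrt{a^2+4b}}{2}$. A metallic Riemannian manifold $(M_n,g,J)$ is a manifold with a Riemannian metric $g$ and a metallic structure $J$ such that $g(JX,Y)=g(X,JY)$ for all $X,Y\in\chi(M_n)$. The associated almost product structure ($F^2=I$) is $F=\frac{2}{2\rho_{a,b}-a}J-\frac{a}{2\rho_{a,b}-a}I$. $L$ and $M$ are the complementary eigendistributions of $J$ for the eigenvalues $\rho_{a,b}$ and $a-\rho_{a,b}$ respectively, with projectors $l=\frac{1}{2\rho_{a,b}-a}J-\frac{a-\rho_{a,b}}{2\rho_{a,b}-a}I$ and $m=-\frac{1}{2\rho_{a,b}-a}J+\frac{\rho_{a,b}}{2\rho_{a,b}-a}I$. For a $(1,1)$-tensor field $A$, $N_A(X,Y)=A^2[X,Y]+[AX,AY]-A[AX,Y]-A[X,AY]$ is its Nijenhuis tensor; $J$ is integrable if $N_J\equiv0$. A linear connection is symmetric if it is torsion-free. A Riemannian almost product structure $(g,F)$ is a locally product structure if $F$ is parallel with respect to the Levi-Civita connection $\overset{g}{\nabla}$ of $g$, i.e. $\overset{g}{\nabla}F=0$; $(M_n,g,J)$ is a locally product metallic Riemannian manifold if its associated $F$ has this property. *)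

theory Defs
  imports "HOL-Analysis.Analysis" "HOL-Library.Function_Algebras"
begin

section \<open>Smooth maps between Euclidean spaces\<close>

text \<open>Intended for open \<open>S\<close>: all iterated directional derivatives up to order \<open>k\<close> exist
  as Frechet derivatives and are continuous.\<close>

primrec Ck_on :: "nat \<Rightarrow> ('b::real_normed_vector \<Rightarrow> 'c::real_normed_vector) \<Rightarrow> 'b set \<Rightarrow> bool" where
  "Ck_on 0 f S \<longleftrightarrow> continuous_on S f"
| "Ck_on (Suc k) f S \<longleftrightarrow>
     (\<forall>x\<in>S. f differentiable (at x)) \<and>
     (\<forall>v. Ck_on k (\<lambda>x. frechet_derivative f (at x) v) S)"

definition smooth_on :: "('b::real_normed_vector \<Rightarrow> 'c::real_normed_vector) \<Rightarrow> 'b set \<Rightarrow> bool" where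
  "smooth_on f S \<longleftrightarrow> (\<forall>k. Ck_on k f S)"


section \<open>Smooth manifolds\<close>

text \<open>The underlying space of the manifold is a whole type \<open>'a\<close> (Hausdorff and second countable by
  its type classes), the dimension is \<open>CARD('n)\<close>, and the smooth structure is given by an atlas,
  which need not be maximal.\<close>

type_synonym ('a, 'n) chart = "'a set \<times> ('a \<Rightarrow> real ^ 'n)"

definition is_chart :: "('a::topological_space, 'n::finite) chart \<Rightarrow> bool" where
  "is_chart c \<longleftrightarrow> (case c of (U, \<phi>) \<Rightarrow>
     open U \<and> open (\<phi> ` U) \<and> homeomorphism U (\<phi> ` U) \<phi> (inv_into U \<phi>))"

definition smooth_atlas ::
  "('a::{t2_space, second_countable_topology}, 'n::finite) chart set \<Rightarrow> bool" where
  "smooth_atlas \<A> \<longleftrightarrow>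
     (\<forall>c\<in>\<A>. is_chart c) \<and>
     (\<Union>(U, \<phi>)\<in>\<A>. U) = UNIV \<and>
     (\<forall>(U, \<phi>)\<in>\<A>. \<forall>(V, \<psi>)\<in>\<A>. smooth_on (\<psi> \<circ> inv_into U \<phi>) (\<phi> ` (U \<inter> V)))"

definition smooth_functions ::
  "('a::{t2_space, second_countable_topology}, 'n::finite) chart set \<Rightarrow> ('a \<Rightarrow> real) set" where
  "smooth_functions \<A> = {f. \<forall>(U, \<phi>)\<in>\<A>. smooth_on (f \<circ> inv_into U \<phi>) (\<phi> ` U)}"


section \<open>Tangent vectors, vector fields, Lie bracket\<close>

text \<open>Tangent vectors at \<open>p\<close> are derivations at \<open>p\<close> of the algebra of smooth functions.
  They are represented by functionals on all real functions that vanish off the smooth ones, so that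
  HOL equality is equality of derivations.  Addition, subtraction and zero are
  pointwise.\<close>

type_synonym 'a tangent = "('a \<Rightarrow> real) \<Rightarrow> real"
type_synonym 'a vfield = "'a \<Rightarrow> 'a tangent"
type_synonym 'a tensor11 = "'a \<Rightarrow> 'a tangent \<Rightarrow> 'a tangent"
type_synonym 'a tensor02 = "'a \<Rightarrow> 'a tangent \<Rightarrow> 'a tangent \<Rightarrow> real"
type_synonym 'a conn = "'a vfield \<Rightarrow> 'a vfield \<Rightarrow> 'a vfield"

definition tscale :: "real \<Rightarrow> 'a tangent \<Rightarrow> 'a tangent" (infixr "*\<^sub>T" 75) where
  "c *\<^sub>T v = (\<lambda>f. c * v f)"

definition tangent_space ::
  "('a::{t2_space, second_countable_topology}, 'n::finite) chart set \<Rightarrow> 'a \<Rightarrow> 'a tangent set" where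
  "tangent_space \<A> p = {v.
     (\<forall>f. f \<notin> smooth_functions \<A> \<longrightarrow> v f = 0) \<and>
     (\<forall>f\<in>smooth_functions \<A>. \<forall>h\<in>smooth_functions \<A>. v (\<lambda>q. f q + h q) = v f + v h) \<and>
     (\<forall>c. \<forall>f\<in>smooth_functions \<A>. v (\<lambda>q. c * f q) = c * v f) \<and>
     (\<forall>f\<in>smooth_functions \<A>. \<forall>h\<in>smooth_functions \<A>.
        v (\<lambda>q. f q * h q) = v f * h p + f p * v h)}"

definition vderiv :: "'a vfield \<Rightarrow> ('a \<Rightarrow> real) \<Rightarrow> 'a \<Rightarrow> real" where
  "vderiv X f = (\<lambda>p. X p f)"

definition vector_fields ::
  "('a::{t2_space, second_countable_topology}, 'n::finite) chart set \<Rightarrow> 'a vfield set" where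
  "vector_fields \<A> = {X.
     (\<forall>p. X p \<in> tangent_space \<A> p) \<and>
     (\<forall>f\<in>smooth_functions \<A>. vderiv X f \<in> smooth_functions \<A>)}"

definition fscale :: "('a \<Rightarrow> real) \<Rightarrow> 'a vfield \<Rightarrow> 'a vfield" (infixr "*\<^sub>F" 75) where
  "f *\<^sub>F X = (\<lambda>p. f p *\<^sub>T X p)"

definition lie_bracket :: "'a vfield \<Rightarrow> 'a vfield \<Rightarrow> 'a vfield" where
  "lie_bracket X Y = (\<lambda>p f. X p (vderiv Y f) - Y p (vderiv X f))"


section \<open>Tensor fields\<close>

definition tapply :: "'a tensor11 \<Rightarrow> 'a vfield \<Rightarrow> 'a vfield" (infixr "\<cdot>" 80) where
  "A \<cdot> X = (\<lambda>p. A p (X p))"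

definition tensor_field11 ::
  "('a::{t2_space, second_countable_topology}, 'n::finite) chart set \<Rightarrow> 'a tensor11 \<Rightarrow> bool" where
  "tensor_field11 \<A> A \<longleftrightarrow>
     (\<forall>p. \<forall>v\<in>tangent_space \<A> p. A p v \<in> tangent_space \<A> p) \<and>
     (\<forall>p. \<forall>v\<in>tangent_space \<A> p. \<forall>w\<in>tangent_space \<A> p. A p (v + w) = A p v + A p w) \<and>
     (\<forall>p c. \<forall>v\<in>tangent_space \<A> p. A p (c *\<^sub>T v) = c *\<^sub>T A p v) \<and>
     (\<forall>X\<in>vector_fields \<A>. A \<cdot> X \<in> vector_fields \<A>)"

definition gfun :: "'a tensor02 \<Rightarrow> 'a vfield \<Rightarrow> 'a vfield \<Rightarrow> 'a \<Rightarrow> real" where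
  "gfun g X Y = (\<lambda>p. g p (X p) (Y p))"

definition riemannian_metric ::
  "('a::{t2_space, second_countable_topology}, 'n::finite) chart set \<Rightarrow> 'a tensor02 \<Rightarrow> bool" where
  "riemannian_metric \<A> g \<longleftrightarrow>
     (\<forall>p. \<forall>u\<in>tangent_space \<A> p. \<forall>v\<in>tangent_space \<A> p. \<forall>w\<in>tangent_space \<A> p.
        g p (u + v) w = g p u w + g p v w) \<and>
     (\<forall>p c. \<forall>v\<in>tangent_space \<A> p. \<forall>w\<in>tangent_space \<A> p. g p (c *\<^sub>T v) w = c * g p v w) \<and>
     (\<forall>p. \<forall>v\<in>tangent_space \<A> p. \<forall>w\<in>tangent_space \<A> p. g p v w = g p w v) \<and>
     (\<forall>p. \<forall>v\<in>tangent_space \<A> p. v \<noteq> 0 \<longrightarrow> g p v v > 0) \<and>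
     (\<forall>X\<in>vector_fields \<A>. \<forall>Y\<in>vector_fields \<A>. gfun g X Y \<in> smooth_functions \<A>)"

definition nijenhuis :: "'a tensor11 \<Rightarrow> 'a vfield \<Rightarrow> 'a vfield \<Rightarrow> 'a vfield" where
  "nijenhuis A X Y =
     A \<cdot> A \<cdot> lie_bracket X Y + lie_bracket (A \<cdot> X) (A \<cdot> Y)
     - A \<cdot> lie_bracket (A \<cdot> X) Y - A \<cdot> lie_bracket X (A \<cdot> Y)"

definition integrable_tensor ::
  "('a::{t2_space, second_countable_topology}, 'n::finite) chart set \<Rightarrow> 'a tensor11 \<Rightarrow> bool" where
  "integrable_tensor \<A> A \<longleftrightarrow>
     (\<forall>X\<in>vector_fields \<A>. \<forall>Y\<in>vector_fields \<A>. nijenhuis A X Y = 0)"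

definition g_symmetric ::
  "('a::{t2_space, second_countable_topology}, 'n::finite) chart set
    \<Rightarrow> 'a tensor02 \<Rightarrow> 'a tensor11 \<Rightarrow> bool" where
  "g_symmetric \<A> g A \<longleftrightarrow>
     (\<forall>X\<in>vector_fields \<A>. \<forall>Y\<in>vector_fields \<A>. gfun g (A \<cdot> X) Y = gfun g X (A \<cdot> Y))"


section \<open>Linear connections\<close>

definition linear_connection ::
  "('a::{t2_space, second_countable_topology}, 'n::finite) chart set \<Rightarrow> 'a conn \<Rightarrow> bool" where
  "linear_connection \<A> D \<longleftrightarrow>
     (\<forall>X\<in>vector_fields \<A>. \<forall>Y\<in>vector_fields \<A>. D X Y \<in> vector_fields \<A>) \<and>
     (\<forall>X\<in>vector_fields \<A>. \<forall>Y\<in>vector_fields \<A>. \<forall>Z\<in>vector_fields \<A>.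
        D (X + Y) Z = D X Z + D Y Z) \<and>
     (\<forall>f\<in>smooth_functions \<A>. \<forall>X\<in>vector_fields \<A>. \<forall>Y\<in>vector_fields \<A>.
        D (f *\<^sub>F X) Y = f *\<^sub>F D X Y) \<and>
     (\<forall>X\<in>vector_fields \<A>. \<forall>Y\<in>vector_fields \<A>. \<forall>Z\<in>vector_fields \<A>.
        D X (Y + Z) = D X Y + D X Z) \<and>
     (\<forall>f\<in>smooth_functions \<A>. \<forall>X\<in>vector_fields \<A>. \<forall>Y\<in>vector_fields \<A>.
        D X (f *\<^sub>F Y) = vderiv X f *\<^sub>F Y + f *\<^sub>F D X Y)"

definition symmetric_connection ::
  "('a::{t2_space, second_countable_topology}, 'n::finite) chart set \<Rightarrow> 'a conn \<Rightarrow> bool" where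
  "symmetric_connection \<A> D \<longleftrightarrow>
     linear_connection \<A> D \<and>
     (\<forall>X\<in>vector_fields \<A>. \<forall>Y\<in>vector_fields \<A>. D X Y - D Y X - lie_bracket X Y = 0)"

definition levi_civita_connection ::
  "('a::{t2_space, second_countable_topology}, 'n::finite) chart set
    \<Rightarrow> 'a tensor02 \<Rightarrow> 'a conn \<Rightarrow> bool" where
  "levi_civita_connection \<A> g D \<longleftrightarrow>
     symmetric_connection \<A> D \<and>
     (\<forall>X\<in>vector_fields \<A>. \<forall>Y\<in>vector_fields \<A>. \<forall>Z\<in>vector_fields \<A>.
        vderiv X (gfun g Y Z) = gfun g (D X Y) Z + gfun g Y (D X Z))"

text \<open>\<open>cov_deriv D X A Y\<close> is the vector field \<open>(D\<^sub>X A) Y\<close>.\<close>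

definition cov_deriv ::
  "'a conn \<Rightarrow> 'a vfield \<Rightarrow> 'a tensor11 \<Rightarrow> 'a vfield \<Rightarrow> 'a vfield" where
  "cov_deriv D X A Y = D X (A \<cdot> Y) - A \<cdot> D X Y"

definition parallel_tensor ::
  "('a::{t2_space, second_countable_topology}, 'n::finite) chart set
    \<Rightarrow> 'a conn \<Rightarrow> 'a tensor11 \<Rightarrow> bool" where
  "parallel_tensor \<A> D A \<longleftrightarrow>
     (\<forall>X\<in>vector_fields \<A>. \<forall>Y\<in>vector_fields \<A>. cov_deriv D X A Y = 0)"


section \<open>Distributions\<close>

definition eigendistribution ::
  "('a::{t2_space, second_countable_topology}, 'n::finite) chart set
    \<Rightarrow> 'a tensor11 \<Rightarrow> real \<Rightarrow> 'a \<Rightarrow> 'a tangent set" where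
  "eigendistribution \<A> A \<mu> p = {v \<in> tangent_space \<A> p. A p v = \<mu> *\<^sub>T v}"

definition sections ::
  "('a::{t2_space, second_countable_topology}, 'n::finite) chart set
    \<Rightarrow> ('a \<Rightarrow> 'a tangent set) \<Rightarrow> 'a vfield set" where
  "sections \<A> E = {X \<in> vector_fields \<A>. \<forall>p. X p \<in> E p}"

definition orthogonal_distributions ::
  "('a::{t2_space, second_countable_topology}, 'n::finite) chart set
    \<Rightarrow> 'a tensor02 \<Rightarrow> ('a \<Rightarrow> 'a tangent set) \<Rightarrow> ('a \<Rightarrow> 'a tangent set) \<Rightarrow> bool" where
  "orthogonal_distributions \<A> g E E' \<longleftrightarrow>
     (\<forall>X\<in>sections \<A> E. \<forall>Y\<in>sections \<A> E'. gfun g X Y = 0)"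


section \<open>Almost product and metallic structures\<close>

definition riemannian_almost_product ::
  "('a::{t2_space, second_countable_topology}, 'n::finite) chart set
    \<Rightarrow> 'a tensor02 \<Rightarrow> 'a tensor11 \<Rightarrow> bool" where
  "riemannian_almost_product \<A> g F \<longleftrightarrow>
     riemannian_metric \<A> g \<and> tensor_field11 \<A> F \<and>
     (\<forall>p. \<forall>v\<in>tangent_space \<A> p. F p (F p v) = v) \<and>
     g_symmetric \<A> g F"

text \<open>The Levi-Civita connection is unique as an operator on vector fields (proved below), so the
  existential quantifier only names it.\<close>

definition locally_product_structure ::
  "('a::{t2_space, second_countable_topology}, 'n::finite) chart set
    \<Rightarrow> 'a tensor02 \<Rightarrow> 'a tensor11 \<Rightarrow> bool" where
  "locally_product_structure \<A> g F \<longleftrightarrow>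
     riemannian_almost_product \<A> g F \<and>
     (\<exists>D. levi_civita_connection \<A> g D \<and> parallel_tensor \<A> D F)"

definition metallic_structure ::
  "nat \<Rightarrow> nat \<Rightarrow> ('a::{t2_space, second_countable_topology}, 'n::finite) chart set
    \<Rightarrow> 'a tensor11 \<Rightarrow> bool" where
  "metallic_structure a b \<A> J \<longleftrightarrow>
     tensor_field11 \<A> J \<and>
     (\<forall>p. \<forall>v\<in>tangent_space \<A> p. J p (J p v) = real a *\<^sub>T J p v + real b *\<^sub>T v)"

definition metallic_riemannian ::
  "nat \<Rightarrow> nat \<Rightarrow> ('a::{t2_space, second_countable_topology}, 'n::finite) chart set
    \<Rightarrow> 'a tensor02 \<Rightarrow> 'a tensor11 \<Rightarrow> bool" where
  "metallic_riemannian a b \<A> g J \<longleftrightarrow>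
     smooth_atlas \<A> \<and> riemannian_metric \<A> g \<and> metallic_structure a b \<A> J \<and> g_symmetric \<A> g J"

definition metallic_mean :: "nat \<Rightarrow> nat \<Rightarrow> real" where
  "metallic_mean a b = (real a + sqrt (real a ^ 2 + 4 * real b)) / 2"

definition assoc_F :: "nat \<Rightarrow> nat \<Rightarrow> 'a tensor11 \<Rightarrow> 'a tensor11" where
  "assoc_F a b J = (\<lambda>p v.
     (2 / (2 * metallic_mean a b - real a)) *\<^sub>T J p v
     - (real a / (2 * metallic_mean a b - real a)) *\<^sub>T v)"

definition proj_l :: "nat \<Rightarrow> nat \<Rightarrow> 'a tensor11 \<Rightarrow> 'a tensor11" where
  "proj_l a b J = (\<lambda>p v.
     (1 / (2 * metallic_mean a b - real a)) *\<^sub>T J p v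
     - ((real a - metallic_mean a b) / (2 * metallic_mean a b - real a)) *\<^sub>T v)"

definition proj_m :: "nat \<Rightarrow> nat \<Rightarrow> 'a tensor11 \<Rightarrow> 'a tensor11" where
  "proj_m a b J = (\<lambda>p v.
     (- 1 / (2 * metallic_mean a b - real a)) *\<^sub>T J p v
     + (metallic_mean a b / (2 * metallic_mean a b - real a)) *\<^sub>T v)"

definition dist_L ::
  "nat \<Rightarrow> nat \<Rightarrow> ('a::{t2_space, second_countable_topology}, 'n::finite) chart set
    \<Rightarrow> 'a tensor11 \<Rightarrow> 'a \<Rightarrow> 'a tangent set" where
  "dist_L a b \<A> J = eigendistribution \<A> J (metallic_mean a b)"

definition dist_M ::
  "nat \<Rightarrow> nat \<Rightarrow> ('a::{t2_space, second_countable_topology}, 'n::finite) chart set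
    \<Rightarrow> 'a tensor11 \<Rightarrow> 'a \<Rightarrow> 'a tangent set" where
  "dist_M a b \<A> J = eigendistribution \<A> J (real a - metallic_mean a b)"

definition locally_product_metallic ::
  "nat \<Rightarrow> nat \<Rightarrow> ('a::{t2_space, second_countable_topology}, 'n::finite) chart set
    \<Rightarrow> 'a tensor02 \<Rightarrow> 'a tensor11 \<Rightarrow> bool" where
  "locally_product_metallic a b \<A> g J \<longleftrightarrow>
     metallic_riemannian a b \<A> g J \<and> locally_product_structure \<A> g (assoc_F a b J)"


section \<open>Uniqueness of the Levi-Civita connection\<close>

lemma tangent_space_scale:
  assumes "v \<in> tangent_space \<A> p"
  shows "c *\<^sub>T v \<in> tangent_space \<A> p"
  using assms unfolding tangent_space_def tscale_def by (simp add: algebra_simps)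

lemma tangent_space_add:
  assumes "v \<in> tangent_space \<A> p" "w \<in> tangent_space \<A> p"
  shows "v + w \<in> tangent_space \<A> p"
  using assms unfolding tangent_space_def by (simp add: algebra_simps)

lemma tscale_minus: "v - w = v + (- 1) *\<^sub>T w"
  by (simp add: tscale_def fun_eq_iff)

lemma tangent_space_diff:
  assumes "v \<in> tangent_space \<A> p" "w \<in> tangent_space \<A> p"
  shows "v - w \<in> tangent_space \<A> p"
  unfolding tscale_minus by (intro tangent_space_add tangent_space_scale assms)

lemma metric_diff_left:
  assumes "riemannian_metric \<A> g"
    and "u \<in> tangent_space \<A> p" "v \<in> tangent_space \<A> p" "w \<in> tangent_space \<A> p"
  shows "g p (u - v) w = g p u w - g p v w"
proof -
  have "g p (u + (- 1) *\<^sub>T v) w = g p u w + g p ((- 1) *\<^sub>T v) w"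
    using assms tangent_space_scale[OF assms(3)] unfolding riemannian_metric_def by blast
  moreover have "g p ((- 1) *\<^sub>T v) w = - 1 * g p v w"
    using assms unfolding riemannian_metric_def by blast
  ultimately show ?thesis
    unfolding tscale_minus by simp
qed

lemma metric_diff_right:
  assumes "riemannian_metric \<A> g"
    and "u \<in> tangent_space \<A> p" "v \<in> tangent_space \<A> p" "w \<in> tangent_space \<A> p"
  shows "g p w (u - v) = g p w u - g p w v"
proof -
  have sym: "g p x y = g p y x" if "x \<in> tangent_space \<A> p" "y \<in> tangent_space \<A> p" for x y
    using assms(1) that unfolding riemannian_metric_def by blast
  show ?thesis
    using metric_diff_left[OF assms] sym assms(2-4) tangent_space_diff[OF assms(2,3)] by simp
qed

lemma levi_civita_unique:
  assumes g: "riemannian_metric \<A> g"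
    and D: "levi_civita_connection \<A> g D" and D': "levi_civita_connection \<A> g D'"
    and X: "X \<in> vector_fields \<A>" and Y: "Y \<in> vector_fields \<A>"
  shows "D X Y = D' X Y"
proof
  fix p
  let ?V = "vector_fields \<A>" and ?T = "tangent_space \<A> p"
  define S where "S X Y = D X Y p - D' X Y p" for X Y
  have V_T: "Z p \<in> ?T" if "Z \<in> ?V" for Z
    using that by (simp add: vector_fields_def)
  have DV: "D X Y \<in> ?V" "D' X Y \<in> ?V" if "X \<in> ?V" "Y \<in> ?V" for X Y
    using D D' that
    by (simp_all add: levi_civita_connection_def symmetric_connection_def linear_connection_def)
  have S_T: "S X Y \<in> ?T" if "X \<in> ?V" "Y \<in> ?V" for X Y
    unfolding S_def by (intro tangent_space_diff V_T DV that)
  have sym: "g p v w = g p w v" if "v \<in> ?T" "w \<in> ?T" for v w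
    using g that unfolding riemannian_metric_def by blast
  have pos: "v \<noteq> 0 \<Longrightarrow> g p v v > 0" if "v \<in> ?T" for v
    using g that unfolding riemannian_metric_def by blast
  have S_sym: "S X Y = S Y X" if "X \<in> ?V" "Y \<in> ?V" for X Y
  proof -
    have "D X Y - D Y X - lie_bracket X Y = 0" "D' X Y - D' Y X - lie_bracket X Y = 0"
      using D D' that by (simp_all only: levi_civita_connection_def symmetric_connection_def)
    then have eq: "(D X Y - D Y X - lie_bracket X Y) p f = (D' X Y - D' Y X - lie_bracket X Y) p f"
      for f by simp
    show ?thesis
    proof
      fix f show "S X Y f = S Y X f"
        using eq[of f] unfolding S_def by simp
    qed
  qed
  have S_skew: "g p (S X Y) (Z p) = - g p (S X Z) (Y p)"
    if "X \<in> ?V" "Y \<in> ?V" "Z \<in> ?V" for X Y Z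
  proof -
    have "vderiv X (gfun g Y Z) = gfun g (D X Y) Z + gfun g Y (D X Z)"
      using D that unfolding levi_civita_connection_def by blast
    moreover have "vderiv X (gfun g Y Z) = gfun g (D' X Y) Z + gfun g Y (D' X Z)"
      using D' that unfolding levi_civita_connection_def by blast
    ultimately have "(gfun g (D X Y) Z + gfun g Y (D X Z)) p = (gfun g (D' X Y) Z + gfun g Y (D' X Z)) p"
      by simp
    then have "g p (S X Y) (Z p) + g p (Y p) (S X Z) = 0"
      unfolding S_def using DV that V_T
      by (simp add: gfun_def metric_diff_left[OF g] metric_diff_right[OF g])
    then show ?thesis
      using sym[OF V_T[OF that(2)] S_T[OF that(1,3)]] by linarith
  qed
  have S_zero: "g p (S X Y) (Z p) = 0" if Z: "Z \<in> ?V" for Z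
  proof -
    have "g p (S X Y) (Z p) = - g p (S X Z) (Y p)" by (rule S_skew[OF X Y Z])
    also have "\<dots> = - g p (S Z X) (Y p)" by (simp only: S_sym[OF X Z])
    also have "\<dots> = g p (S Z Y) (X p)" by (simp only: S_skew[OF Z X Y] minus_minus)
    also have "\<dots> = g p (S Y Z) (X p)" by (simp only: S_sym[OF Z Y])
    also have "\<dots> = - g p (S Y X) (Z p)" by (rule S_skew[OF Y Z X])
    also have "\<dots> = - g p (S X Y) (Z p)" by (simp only: S_sym[OF Y X])
    finally show ?thesis by simp
  qed
  have "g p (S X Y) (S X Y) = 0"
  proof -
    have "g p (S X Y) (D X Y p - D' X Y p) = 0"
      by (simp only: metric_diff_right[OF g V_T[OF DV(1)[OF X Y]] V_T[OF DV(2)[OF X Y]] S_T[OF X Y]]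
          S_zero[OF DV(1)[OF X Y]] S_zero[OF DV(2)[OF X Y]] diff_self)
    then show ?thesis
      unfolding S_def .
  qed
  then have "S X Y = 0"
    using pos[OF S_T[OF X Y]] by fastforce
  then show "D X Y p = D' X Y p"
    unfolding S_def by simp
qed

end

theory Submission
  imports Defs
begin

text \<open>
  Write \<open>\<rho>\<close> for the metallic mean and \<open>s = 2 * \<rho> - a\<close>, which is the positive square root of
  \<open>a\<^sup>2 + 4 * b\<close>.  The tensors \<open>l\<close>, \<open>m\<close> and \<open>F\<close> all have the form \<open>c J + d I\<close> with constants \<open>c\<close>
  and \<open>d\<close>, and since \<open>s\<close> is nonzero \<open>J\<close> has this form relative to \<open>F\<close>.  What passes from a tensor
  to its affine combinations with the identity is therefore the common tool: being a tensor field
  (\<open>tensor_field11_affine\<close>), \<open>g\<close>-symmetry (\<open>g_symmetric_affine\<close>) and being parallel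
  (\<open>parallel_affine\<close>).

  The \<open>g\<close>-symmetry of the projectors is immediate from this.  The numbers \<open>\<rho>\<close> and \<open>a - \<rho>\<close> are the
  roots of \<open>t\<^sup>2 = a t + b\<close>, so \<open>l X\<close> and \<open>m X\<close> are eigenvectors of \<open>J\<close>
  (\<open>affine_section_eigendistribution\<close>), and they are orthogonal as eigenvectors of a
  \<open>g\<close>-symmetric operator for different eigenvalues (\<open>eigendistributions_orthogonal\<close>).

  For a tensor \<open>A\<close> with \<open>A\<^sup>2 = c A + d I\<close> one can eliminate the squares of \<open>A\<close> from \<open>N\<^sub>A(A X, Y)\<close>.
  The resulting expression changes sign when \<open>X\<close> and \<open>Y\<close> are exchanged, as \<open>N\<^sub>A\<close> itself does, and
  the two facts together give \<open>N\<^sub>A(A X, Y) = N\<^sub>A(X, A Y)\<close> (\<open>nijenhuis_quadratic_symmetric\<close>).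

  A torsion-free connection expresses every Lie bracket as \<open>D X Y - D Y X\<close>, which turns the
  Nijenhuis tensor of any tensor field into covariant derivatives of it (\<open>nijenhuis_cov_deriv\<close>).
  Thus a tensor field that is parallel for such a connection is integrable, and if \<open>F\<close> is parallel
  for the Levi-Civita connection, then so is \<open>J\<close>.

  A tensor field is linear only on tangent vectors, so these computations rest on \<open>[X, Y]\<close> being a
  vector field (\<open>lie_bracket_vector_field\<close>), which in turn needs smooth functions to be closed under
  sums and products.
\<close>

section \<open>The algebra of smooth functions\<close>

lemma Ck_on_Suc_imp: "Ck_on (Suc k) f S \<Longrightarrow> Ck_on k f S"
proof (induction k arbitrary: f)
  case 0
  then show ?case
    by (auto intro!: continuous_at_imp_continuous_on differentiable_imp_continuous_within)
next
  case (Suc k)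
  then show ?case by (metis Ck_on.simps(2))
qed

text \<open>Openness matters because the derivatives at a point of \<open>S\<close> see the values on a whole
  neighbourhood of it.\<close>

lemma Ck_on_cong:
  assumes S: "open S" and "Ck_on k f S" and "\<And>x. x \<in> S \<Longrightarrow> f x = h x"
  shows "Ck_on k h S"
  using assms(2,3)
proof (induction k arbitrary: f h)
  case 0
  then show ?case by (simp cong: continuous_on_cong_simp)
next
  case (Suc k)
  have f: "f differentiable (at x)" if "x \<in> S" for x
    using Suc.prems(1) that by simp
  have fh: "(h has_derivative frechet_derivative f (at x)) (at x)" if "x \<in> S" for x
    using f[OF that] Suc.prems(2) that S
    by (metis frechet_derivative_works has_derivative_transform_within_open)
  have "frechet_derivative f (at x) = frechet_derivative h (at x)" if "x \<in> S" for x
    using frechet_derivative_at[OF fh[OF that]] .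
  moreover have "Ck_on k (\<lambda>x. frechet_derivative f (at x) v) S" for v
    using Suc.prems(1) by simp
  ultimately have "Ck_on k (\<lambda>x. frechet_derivative h (at x) v) S" for v
    using Suc.IH[of "\<lambda>x. frechet_derivative f (at x) v" "\<lambda>x. frechet_derivative h (at x) v"] by simp
  then show ?case
    using fh by (auto simp: differentiable_def)
qed

lemma Ck_on_const: "Ck_on k (\<lambda>x. c) S"
proof (induction k arbitrary: c)
  case (Suc k)
  have "frechet_derivative (\<lambda>x. c) (at x) = (\<lambda>v. 0)" for x :: 'a
    using frechet_derivative_at[OF has_derivative_const[of c "at x"]] by simp
  then show ?case using Suc by simp
qed simp

lemma Ck_on_add:
  assumes S: "open S" and "Ck_on k f S" and "Ck_on k h S"
  shows "Ck_on k (\<lambda>x. f x + h x) S"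
  using assms(2,3)
proof (induction k arbitrary: f h)
  case 0
  then show ?case by (simp add: continuous_on_add)
next
  case (Suc k)
  have deriv: "frechet_derivative (\<lambda>x. f x + h x) (at x) =
      (\<lambda>v. frechet_derivative f (at x) v + frechet_derivative h (at x) v)" if "x \<in> S" for x
    using Suc.prems that
    by (auto intro!: frechet_derivative_at[symmetric] has_derivative_add simp: frechet_derivative_works[symmetric])
  have Ck: "Ck_on k (\<lambda>x. frechet_derivative f (at x) v + frechet_derivative h (at x) v) S" for v
    using Suc.prems by (intro Suc.IH) auto
  have "Ck_on k (\<lambda>x. frechet_derivative (\<lambda>x. f x + h x) (at x) v) S" for v
    by (rule Ck_on_cong[OF S Ck]) (simp add: deriv)
  then show ?case
    using Suc.prems by simp
qed

text \<open>The product rule expresses the derivative of \<open>f * h\<close> by products of \<open>C\<^sup>k\<close> functions, where a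
  factor that is not differentiated is \<open>C\<^sup>k\<close> because it is even \<open>C\<^sup>k\<^sup>+\<^sup>1\<close>.\<close>

lemma Ck_on_mult:
  fixes f h :: "'b::real_normed_vector \<Rightarrow> 'c::real_normed_algebra"
  assumes S: "open S" and "Ck_on k f S" and "Ck_on k h S"
  shows "Ck_on k (\<lambda>x. f x * h x) S"
  using assms(2,3)
proof (induction k arbitrary: f h)
  case 0
  then show ?case by (simp add: continuous_on_mult)
next
  case (Suc k)
  have deriv: "frechet_derivative (\<lambda>x. f x * h x) (at x) =
      (\<lambda>v. f x * frechet_derivative h (at x) v + frechet_derivative f (at x) v * h x)" if "x \<in> S" for x
    using Suc.prems that
    by (auto intro!: frechet_derivative_at[symmetric] has_derivative_mult simp: frechet_derivative_works[symmetric])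
  have Ck: "Ck_on k (\<lambda>x. f x * frechet_derivative h (at x) v + frechet_derivative f (at x) v * h x) S" for v
    using Suc.prems Ck_on_Suc_imp[OF Suc.prems(1)] Ck_on_Suc_imp[OF Suc.prems(2)]
    by (intro Ck_on_add[OF S] Suc.IH) auto
  have "Ck_on k (\<lambda>x. frechet_derivative (\<lambda>x. f x * h x) (at x) v) S" for v
    by (rule Ck_on_cong[OF S Ck]) (simp add: deriv)
  then show ?case
    using Suc.prems by simp
qed

lemma smooth_functions_const: "(\<lambda>q. c) \<in> smooth_functions \<A>"
  by (simp add: smooth_functions_def smooth_on_def o_def Ck_on_const split: prod.splits)

lemma chart_image_open:
  assumes "smooth_atlas \<A>" and "(U, \<phi>) \<in> \<A>"
  shows "open (\<phi> ` U)"
  using assms by (auto simp: smooth_atlas_def is_chart_def)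

lemma smooth_functions_add:
  assumes "smooth_atlas \<A>" and "f \<in> smooth_functions \<A>" and "h \<in> smooth_functions \<A>"
  shows "(\<lambda>q. f q + h q) \<in> smooth_functions \<A>"
  using assms chart_image_open[OF assms(1)]
  by (fastforce simp: smooth_functions_def smooth_on_def o_def intro: Ck_on_add)

lemma smooth_functions_mult:
  assumes "smooth_atlas \<A>" and "f \<in> smooth_functions \<A>" and "h \<in> smooth_functions \<A>"
  shows "(\<lambda>q. f q * h q) \<in> smooth_functions \<A>"
  using assms chart_image_open[OF assms(1)]
  by (fastforce simp: smooth_functions_def smooth_on_def o_def intro: Ck_on_mult)

lemma smooth_functions_lincomb:
  assumes "smooth_atlas \<A>" and "f \<in> smooth_functions \<A>" and "h \<in> smooth_functions \<A>"
  shows "(\<lambda>q. c * f q + d * h q) \<in> smooth_functions \<A>"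
  using assms by (intro smooth_functions_add smooth_functions_mult smooth_functions_const)

section \<open>Vector fields and the Lie bracket\<close>

lemma tangent_nonsmooth: "v \<in> tangent_space \<A> p \<Longrightarrow> f \<notin> smooth_functions \<A> \<Longrightarrow> v f = 0"
  by (simp add: tangent_space_def)

lemma tangent_lincomb:
  assumes "smooth_atlas \<A>" and "v \<in> tangent_space \<A> p"
    and "f \<in> smooth_functions \<A>" and "h \<in> smooth_functions \<A>"
  shows "v (\<lambda>q. c * f q + d * h q) = c * v f + d * v h"
proof -
  have "(\<lambda>q. c * f q) \<in> smooth_functions \<A>" "(\<lambda>q. d * h q) \<in> smooth_functions \<A>"
    using assms by (intro smooth_functions_mult smooth_functions_const; simp)+
  then show ?thesis
    using assms by (simp add: tangent_space_def)
qed

lemma tangent_add: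
  assumes "v \<in> tangent_space \<A> p" and "f \<in> smooth_functions \<A>" and "h \<in> smooth_functions \<A>"
  shows "v (\<lambda>q. f q + h q) = v f + v h"
  using assms by (simp add: tangent_space_def)

lemma tangent_mult:
  assumes "v \<in> tangent_space \<A> p" and "f \<in> smooth_functions \<A>" and "h \<in> smooth_functions \<A>"
  shows "v (\<lambda>q. f q * h q) = v f * h p + f p * v h"
  using assms by (simp add: tangent_space_def)

lemma tangent_scale:
  assumes "v \<in> tangent_space \<A> p" and "f \<in> smooth_functions \<A>"
  shows "v (\<lambda>q. c * f q) = c * v f"
  using assms by (simp add: tangent_space_def)

text \<open>The Leibniz rule for \<open>1 * 1 = 1\<close> gives \<open>v 1 = 2 * v 1\<close>, so \<open>v 1 = 0\<close>.\<close>

lemma tangent_const: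
  assumes "v \<in> tangent_space \<A> p"
  shows "v (\<lambda>q. c) = 0"
proof -
  have one: "(\<lambda>q. 1) \<in> smooth_functions \<A>"
    by (rule smooth_functions_const)
  have "v (\<lambda>q. 1 * 1) = v (\<lambda>q. 1) * 1 + 1 * v (\<lambda>q. 1)"
    by (rule tangent_mult[OF assms one one])
  then have "v (\<lambda>q. 1) = 0"
    by simp
  then show ?thesis
    using tangent_scale[OF assms one, of c] by simp
qed

lemma vector_field_tangent: "X \<in> vector_fields \<A> \<Longrightarrow> X p \<in> tangent_space \<A> p"
  by (simp add: vector_fields_def)

lemma vector_field_smooth:
  "X \<in> vector_fields \<A> \<Longrightarrow> f \<in> smooth_functions \<A> \<Longrightarrow> vderiv X f \<in> smooth_functions \<A>"
  by (simp add: vector_fields_def)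

lemma vderiv_nonsmooth:
  "X \<in> vector_fields \<A> \<Longrightarrow> f \<notin> smooth_functions \<A> \<Longrightarrow> vderiv X f = (\<lambda>p. 0)"
  by (simp add: vderiv_def fun_eq_iff tangent_nonsmooth[OF vector_field_tangent])

lemma vector_fields_lincomb:
  assumes \<A>: "smooth_atlas \<A>" and X: "X \<in> vector_fields \<A>" and Y: "Y \<in> vector_fields \<A>"
  shows "(\<lambda>p. c *\<^sub>T X p + d *\<^sub>T Y p) \<in> vector_fields \<A>"
proof -
  have "vderiv (\<lambda>p. c *\<^sub>T X p + d *\<^sub>T Y p) f \<in> smooth_functions \<A>" if "f \<in> smooth_functions \<A>" for f
    using smooth_functions_lincomb[OF \<A> vector_field_smooth[OF X that] vector_field_smooth[OF Y that], of c d]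
    by (simp add: vderiv_def tscale_def)
  then show ?thesis
    unfolding vector_fields_def
    by (simp add: tangent_space_add tangent_space_scale vector_field_tangent[OF X] vector_field_tangent[OF Y])
qed

text \<open>On smooth functions this is the classical commutator of derivations.  On a function \<open>f\<close> that
  is not smooth the tangent vectors of \<open>X\<close> and \<open>Y\<close> take the value zero, so that \<open>X f\<close> and \<open>Y f\<close>
  are the zero function, which every tangent vector annihilates.\<close>

lemma lie_bracket_vector_field:
  assumes \<A>: "smooth_atlas \<A>" and X: "X \<in> vector_fields \<A>" and Y: "Y \<in> vector_fields \<A>"
  shows "lie_bracket X Y \<in> vector_fields \<A>"
proof -
  note T = vector_field_tangent[OF X] vector_field_tangent[OF Y]
  note S = vector_field_smooth[OF X] vector_field_smooth[OF Y]
  have "lie_bracket X Y p \<in> tangent_space \<A> p" for p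
    unfolding tangent_space_def
  proof (intro CollectI conjI ballI allI impI)
    fix f assume "f \<notin> smooth_functions \<A>"
    then show "lie_bracket X Y p f = 0"
      by (simp add: lie_bracket_def vderiv_nonsmooth[OF X] vderiv_nonsmooth[OF Y] tangent_const[OF T(1)]
          tangent_const[OF T(2)])
  next
    fix f h assume f: "f \<in> smooth_functions \<A>" and h: "h \<in> smooth_functions \<A>"
    have "vderiv Z (\<lambda>q. f q + h q) = (\<lambda>q. vderiv Z f q + vderiv Z h q)" if "Z \<in> vector_fields \<A>" for Z
      by (simp add: vderiv_def fun_eq_iff tangent_add[OF vector_field_tangent[OF that] f h])
    then show "lie_bracket X Y p (\<lambda>q. f q + h q) = lie_bracket X Y p f + lie_bracket X Y p h"
      using X Y by (simp add: lie_bracket_def tangent_add[OF T(1) S(2)[OF f] S(2)[OF h]]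
          tangent_add[OF T(2) S(1)[OF f] S(1)[OF h]])
    \<comment> \<open>The mixed terms \<open>X f * Y h\<close> and \<open>Y f * X h\<close> of the second derivatives cancel.\<close>
    have leib: "vderiv Z (\<lambda>q. f q * h q) = (\<lambda>q. vderiv Z f q * h q + f q * vderiv Z h q)"
      if "Z \<in> vector_fields \<A>" for Z
      by (simp add: vderiv_def fun_eq_iff tangent_mult[OF vector_field_tangent[OF that] f h])
    have second: "Z p (vderiv W (\<lambda>q. f q * h q)) =
        Z p (vderiv W f) * h p + vderiv W f p * Z p h + (Z p f * vderiv W h p + f p * Z p (vderiv W h))"
      if Z: "Z \<in> vector_fields \<A>" and W: "W \<in> vector_fields \<A>" for Z W
    proof -
      note ZT = vector_field_tangent[OF Z, of p]
      note Wf = vector_field_smooth[OF W f] and Wh = vector_field_smooth[OF W h]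
      show ?thesis
        unfolding leib[OF W]
        by (simp add: tangent_add[OF ZT smooth_functions_mult[OF \<A> Wf h] smooth_functions_mult[OF \<A> f Wh]]
            tangent_mult[OF ZT Wf h] tangent_mult[OF ZT f Wh])
    qed
    show "lie_bracket X Y p (\<lambda>q. f q * h q) =
        lie_bracket X Y p f * h p + f p * lie_bracket X Y p h"
      unfolding lie_bracket_def second[OF X Y] second[OF Y X]
      by (simp add: vderiv_def algebra_simps)
  next
    fix c f assume f: "f \<in> smooth_functions \<A>"
    have "vderiv Z (\<lambda>q. c * f q) = (\<lambda>q. c * vderiv Z f q)" if "Z \<in> vector_fields \<A>" for Z
      by (simp add: vderiv_def fun_eq_iff tangent_scale[OF vector_field_tangent[OF that] f])
    then show "lie_bracket X Y p (\<lambda>q. c * f q) = c * lie_bracket X Y p f"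
      using X Y by (simp add: lie_bracket_def tangent_scale[OF T(1) S(2)[OF f]] tangent_scale[OF T(2) S(1)[OF f]]
          algebra_simps)
  qed
  moreover have "vderiv (lie_bracket X Y) f \<in> smooth_functions \<A>" if "f \<in> smooth_functions \<A>" for f
    using smooth_functions_lincomb[OF \<A> S(1)[OF S(2)[OF that]] S(2)[OF S(1)[OF that]], of 1 "- 1"]
    by (simp add: lie_bracket_def vderiv_def)
  ultimately show ?thesis
    by (simp add: vector_fields_def)
qed

lemma lie_bracket_skew: "lie_bracket X Y = - lie_bracket Y X"
  by (simp add: lie_bracket_def fun_eq_iff)

text \<open>Functions that are not smooth need a case of their own because tangent vectors are additive on
  smooth functions only; there both sides vanish.\<close>

lemma lie_bracket_lincomb_left:
  assumes \<A>: "smooth_atlas \<A>" and X: "X \<in> vector_fields \<A>" and Y: "Y \<in> vector_fields \<A>"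
    and Z: "Z \<in> vector_fields \<A>"
  shows "lie_bracket (\<lambda>p. c *\<^sub>T X p + d *\<^sub>T Y p) Z =
    (\<lambda>p. c *\<^sub>T lie_bracket X Z p + d *\<^sub>T lie_bracket Y Z p)"
proof (intro ext)
  fix p f
  have "Z p (vderiv (\<lambda>p. c *\<^sub>T X p + d *\<^sub>T Y p) f) = c * Z p (vderiv X f) + d * Z p (vderiv Y f)"
  proof (cases "f \<in> smooth_functions \<A>")
    case True
    then show ?thesis
      using tangent_lincomb[OF \<A> vector_field_tangent[OF Z] vector_field_smooth[OF X] vector_field_smooth[OF Y]]
      by (simp add: vderiv_def tscale_def)
  next
    case False
    then show ?thesis
      by (simp add: vderiv_nonsmooth[OF X] vderiv_nonsmooth[OF Y] tangent_const[OF vector_field_tangent[OF Z]]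
          vderiv_nonsmooth[OF vector_fields_lincomb[OF \<A> X Y]])
  qed
  then show "lie_bracket (\<lambda>p. c *\<^sub>T X p + d *\<^sub>T Y p) Z p f =
      (c *\<^sub>T lie_bracket X Z p + d *\<^sub>T lie_bracket Y Z p) f"
    by (simp add: lie_bracket_def tscale_def algebra_simps)
qed

section \<open>Tensor fields of type (1,1) and metrics\<close>

lemma tapply_at: "(A \<cdot> X) p = A p (X p)"
  by (simp add: tapply_def)

lemma tensor_tangent:
  "tensor_field11 \<A> A \<Longrightarrow> v \<in> tangent_space \<A> p \<Longrightarrow> A p v \<in> tangent_space \<A> p"
  by (simp add: tensor_field11_def)

lemma tensor_vector_field: "tensor_field11 \<A> A \<Longrightarrow> X \<in> vector_fields \<A> \<Longrightarrow> A \<cdot> X \<in> vector_fields \<A>"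
  by (simp add: tensor_field11_def)

lemma tensor_lincomb:
  assumes "tensor_field11 \<A> A" and "v \<in> tangent_space \<A> p" and "w \<in> tangent_space \<A> p"
  shows "A p (c *\<^sub>T v + d *\<^sub>T w) = c *\<^sub>T A p v + d *\<^sub>T A p w"
  using assms tangent_space_scale[OF assms(2)] tangent_space_scale[OF assms(3)]
  by (simp add: tensor_field11_def)

lemma tensor_diff:
  assumes "tensor_field11 \<A> A" and "v \<in> tangent_space \<A> p" and "w \<in> tangent_space \<A> p"
  shows "A p (v - w) = A p v - A p w"
  using tensor_lincomb[OF assms, of 1 "- 1"] by (simp add: tscale_def fun_diff_def plus_fun_def)

lemma tensor_uminus:
  assumes "tensor_field11 \<A> A" and "v \<in> tangent_space \<A> p"
  shows "A p (- v) = - A p v"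
  using tensor_lincomb[OF assms assms(2), of "- 1" 0] by (simp add: tscale_def fun_Compl_def plus_fun_def)

lemma tensor_lie_bracket_skew:
  assumes \<A>: "smooth_atlas \<A>" and A: "tensor_field11 \<A> A"
    and X: "X \<in> vector_fields \<A>" and Y: "Y \<in> vector_fields \<A>"
  shows "A p (lie_bracket X Y p) = - A p (lie_bracket Y X p)"
  using tensor_uminus[OF A vector_field_tangent[OF lie_bracket_vector_field[OF \<A> Y X]], of p]
  by (simp add: lie_bracket_skew[of X Y])

definition tensor_affine :: "real \<Rightarrow> real \<Rightarrow> 'a tensor11 \<Rightarrow> 'a tensor11" where
  "tensor_affine c d A = (\<lambda>p v. c *\<^sub>T A p v + d *\<^sub>T v)"

lemma tensor_affine_apply: "tensor_affine c d A \<cdot> X = (\<lambda>p. c *\<^sub>T (A \<cdot> X) p + d *\<^sub>T X p)"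
  unfolding tensor_affine_def tapply_def ..

lemma tensor_field11_affine:
  assumes \<A>: "smooth_atlas \<A>" and A: "tensor_field11 \<A> A"
  shows "tensor_field11 \<A> (tensor_affine c d A)"
  unfolding tensor_field11_def
proof (intro conjI allI ballI)
  fix p v w assume v: "v \<in> tangent_space \<A> p" and w: "w \<in> tangent_space \<A> p"
  show "tensor_affine c d A p (v + w) = tensor_affine c d A p v + tensor_affine c d A p w"
    using A v w by (simp add: tensor_field11_def tensor_affine_def tscale_def fun_eq_iff algebra_simps)
next
  fix p e v assume "v \<in> tangent_space \<A> p"
  then show "tensor_affine c d A p (e *\<^sub>T v) = e *\<^sub>T tensor_affine c d A p v"
    using A by (simp add: tensor_field11_def tensor_affine_def tscale_def fun_eq_iff algebra_simps)
next
  fix p v assume "v \<in> tangent_space \<A> p"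
  then show "tensor_affine c d A p v \<in> tangent_space \<A> p"
    unfolding tensor_affine_def by (intro tangent_space_add tangent_space_scale tensor_tangent[OF A])
next
  fix X assume "X \<in> vector_fields \<A>"
  then show "tensor_affine c d A \<cdot> X \<in> vector_fields \<A>"
    unfolding tensor_affine_apply by (intro vector_fields_lincomb \<A> tensor_vector_field[OF A])
qed

lemma metric_lincomb_left:
  assumes "riemannian_metric \<A> g"
    and "u \<in> tangent_space \<A> p" "v \<in> tangent_space \<A> p" "w \<in> tangent_space \<A> p"
  shows "g p (c *\<^sub>T u + d *\<^sub>T v) w = c * g p u w + d * g p v w"
proof -
  have "g p (c *\<^sub>T u + d *\<^sub>T v) w = g p (c *\<^sub>T u) w + g p (d *\<^sub>T v) w"
    using assms tangent_space_scale[OF assms(2)] tangent_space_scale[OF assms(3)]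
    unfolding riemannian_metric_def by blast
  moreover have "g p (c *\<^sub>T u) w = c * g p u w" "g p (d *\<^sub>T v) w = d * g p v w"
    using assms unfolding riemannian_metric_def by blast+
  ultimately show ?thesis by simp
qed

lemma metric_sym:
  assumes "riemannian_metric \<A> g" "v \<in> tangent_space \<A> p" "w \<in> tangent_space \<A> p"
  shows "g p v w = g p w v"
  using assms unfolding riemannian_metric_def by blast

lemma metric_lincomb_right:
  assumes "riemannian_metric \<A> g"
    and "u \<in> tangent_space \<A> p" "v \<in> tangent_space \<A> p" "w \<in> tangent_space \<A> p"
  shows "g p w (c *\<^sub>T u + d *\<^sub>T v) = c * g p w u + d * g p w v"
  using metric_lincomb_left[OF assms] metric_sym[OF assms(1,4)] assms(2,3)
  by (simp only: tangent_space_add tangent_space_scale)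

lemma g_symmetric_affine:
  assumes g: "riemannian_metric \<A> g" and A: "tensor_field11 \<A> A" and sym: "g_symmetric \<A> g A"
  shows "g_symmetric \<A> g (tensor_affine c d A)"
  unfolding g_symmetric_def
proof (intro ballI ext)
  fix X Y p assume X: "X \<in> vector_fields \<A>" and Y: "Y \<in> vector_fields \<A>"
  have "gfun g (A \<cdot> X) Y p = gfun g X (A \<cdot> Y) p"
    using sym X Y by (simp add: g_symmetric_def)
  then show "gfun g (tensor_affine c d A \<cdot> X) Y p = gfun g X (tensor_affine c d A \<cdot> Y) p"
    using X Y tensor_vector_field[OF A X] tensor_vector_field[OF A Y]
    by (simp add: gfun_def tensor_affine_apply metric_lincomb_left[OF g] metric_lincomb_right[OF g]
        vector_field_tangent)
qed

text \<open>Symmetry gives \<open>\<kappa> * g(X, Y) = g(A X, Y) = g(X, A Y) = \<mu> * g(X, Y)\<close>.\<close>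

lemma eigendistributions_orthogonal:
  assumes g: "riemannian_metric \<A> g" and sym: "g_symmetric \<A> g A" and "\<kappa> \<noteq> \<mu>"
  shows "orthogonal_distributions \<A> g (eigendistribution \<A> A \<kappa>) (eigendistribution \<A> A \<mu>)"
  unfolding orthogonal_distributions_def
proof (intro ballI ext)
  fix X Y p
  assume "X \<in> sections \<A> (eigendistribution \<A> A \<kappa>)" and "Y \<in> sections \<A> (eigendistribution \<A> A \<mu>)"
  then have X: "X \<in> vector_fields \<A>" "A p (X p) = \<kappa> *\<^sub>T X p"
    and Y: "Y \<in> vector_fields \<A>" "A p (Y p) = \<mu> *\<^sub>T Y p"
    by (auto simp: sections_def eigendistribution_def)
  note T = vector_field_tangent[OF X(1), of p] vector_field_tangent[OF Y(1), of p]
  have "gfun g (A \<cdot> X) Y p = gfun g X (A \<cdot> Y) p"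
    using sym X Y by (simp add: g_symmetric_def)
  then have "g p (\<kappa> *\<^sub>T X p) (Y p) = g p (X p) (\<mu> *\<^sub>T Y p)"
    by (simp add: gfun_def tapply_def X Y)
  moreover have "g p (\<kappa> *\<^sub>T X p) (Y p) = \<kappa> * g p (X p) (Y p)"
    using metric_lincomb_left[OF g T(1) T(1) T(2), of \<kappa> 0] by (simp add: tscale_def plus_fun_def)
  moreover have "g p (X p) (\<mu> *\<^sub>T Y p) = \<mu> * g p (X p) (Y p)"
    using metric_lincomb_right[OF g T(2) T(2) T(1), of \<mu> 0] by (simp add: tscale_def plus_fun_def)
  ultimately show "gfun g X Y p = 0 p"
    using \<open>\<kappa> \<noteq> \<mu>\<close> by (simp add: gfun_def)
qed

section \<open>The Nijenhuis tensor\<close>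

lemma nijenhuis_skew:
  assumes \<A>: "smooth_atlas \<A>" and A: "tensor_field11 \<A> A"
    and X: "X \<in> vector_fields \<A>" and Y: "Y \<in> vector_fields \<A>"
  shows "nijenhuis A X Y = - nijenhuis A Y X"
proof
  fix p
  note neg = tensor_lie_bracket_skew[OF \<A> A, where p = p]
  note AV = tensor_vector_field[OF A X] tensor_vector_field[OF A Y]
  have neg2: "A p (A p (lie_bracket X Y p)) = - A p (A p (lie_bracket Y X p))"
    using neg[OF X Y] tensor_uminus[OF A tensor_tangent[OF A vector_field_tangent[OF lie_bracket_vector_field[OF \<A> Y X]]]]
    by simp
  show "nijenhuis A X Y p = (- nijenhuis A Y X) p"
    using lie_bracket_skew[of "A \<cdot> X" "A \<cdot> Y"]
    by (simp add: nijenhuis_def tapply_at neg2 neg[OF AV(1) Y] neg[OF X AV(2)] fun_eq_iff)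
qed

text \<open>The term \<open>c A[A X, Y]\<close> of \<open>A\<^sup>2[A X, Y]\<close> cancels the one that \<open>- A[A\<^sup>2 X, Y]\<close> contributes.
  Every term that is left is skew in \<open>X\<close> and \<open>Y\<close> or is paired with its mirror image.\<close>

lemma nijenhuis_quadratic_left:
  assumes \<A>: "smooth_atlas \<A>" and A: "tensor_field11 \<A> A"
    and quad: "\<forall>p. \<forall>v\<in>tangent_space \<A> p. A p (A p v) = c *\<^sub>T A p v + d *\<^sub>T v"
    and X: "X \<in> vector_fields \<A>" and Y: "Y \<in> vector_fields \<A>"
  shows "nijenhuis A (A \<cdot> X) Y p =
    d *\<^sub>T (lie_bracket (A \<cdot> X) Y p + lie_bracket X (A \<cdot> Y) p - A p (lie_bracket X Y p))
    + c *\<^sub>T lie_bracket (A \<cdot> X) (A \<cdot> Y) p - A p (lie_bracket (A \<cdot> X) (A \<cdot> Y) p)"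
proof -
  note AX = tensor_vector_field[OF A X] and AY = tensor_vector_field[OF A Y]
  note br = vector_field_tangent[OF lie_bracket_vector_field[OF \<A>], of _ _ p]
  have AAX: "A \<cdot> A \<cdot> X = (\<lambda>p. c *\<^sub>T (A \<cdot> X) p + d *\<^sub>T X p)"
    by (simp add: fun_eq_iff tapply_at quad vector_field_tangent[OF X])
  show ?thesis
    unfolding nijenhuis_def AAX lie_bracket_lincomb_left[OF \<A> AX X Y] lie_bracket_lincomb_left[OF \<A> AX X AY]
    by (simp add: tapply_at quad[rule_format, OF br[OF AX Y]] tensor_lincomb[OF A br[OF AX Y] br[OF X Y]])
       (simp add: fun_eq_iff tscale_def algebra_simps)
qed

text \<open>By skew symmetry \<open>N\<^sub>A(X, A Y) = - N\<^sub>A(A Y, X)\<close>, and the formula for \<open>N\<^sub>A(A Y, X)\<close> is the negative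
  of the one for \<open>N\<^sub>A(A X, Y)\<close>.\<close>

lemma nijenhuis_quadratic_symmetric:
  assumes \<A>: "smooth_atlas \<A>" and A: "tensor_field11 \<A> A"
    and quad: "\<forall>p. \<forall>v\<in>tangent_space \<A> p. A p (A p v) = c *\<^sub>T A p v + d *\<^sub>T v"
    and X: "X \<in> vector_fields \<A>" and Y: "Y \<in> vector_fields \<A>"
  shows "nijenhuis A (A \<cdot> X) Y = nijenhuis A X (A \<cdot> Y)"
proof
  fix p
  note AX = tensor_vector_field[OF A X] and AY = tensor_vector_field[OF A Y]
  note neg = tensor_lie_bracket_skew[OF \<A> A, where p = p]
  have "nijenhuis A X (A \<cdot> Y) p = - nijenhuis A (A \<cdot> Y) X p"
    by (simp add: nijenhuis_skew[OF \<A> A X AY])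
  also have "\<dots> = nijenhuis A (A \<cdot> X) Y p"
    unfolding nijenhuis_quadratic_left[OF \<A> A quad X Y] nijenhuis_quadratic_left[OF \<A> A quad Y X]
      neg[OF Y X] neg[OF AY AX]
    by (simp add: lie_bracket_skew[of "A \<cdot> Y" "A \<cdot> X"] lie_bracket_skew[of "A \<cdot> Y" X]
        lie_bracket_skew[of Y "A \<cdot> X"] fun_eq_iff tscale_def algebra_simps)
  finally show "nijenhuis A (A \<cdot> X) Y p = nijenhuis A X (A \<cdot> Y) p" ..
qed

section \<open>Torsion-free connections and parallel tensors\<close>

text \<open>Substituting \<open>[V, W] = D V W - D W V\<close> on the left and expanding the covariant derivatives on
  the right gives the same terms, by the additivity of \<open>A\<close> alone.\<close>

lemma nijenhuis_cov_deriv: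
  assumes A: "tensor_field11 \<A> A" and D: "symmetric_connection \<A> D"
    and X: "X \<in> vector_fields \<A>" and Y: "Y \<in> vector_fields \<A>"
  shows "nijenhuis A X Y =
    cov_deriv D (A \<cdot> X) A Y - cov_deriv D (A \<cdot> Y) A X - A \<cdot> cov_deriv D X A Y + A \<cdot> cov_deriv D Y A X"
proof
  fix p
  note AX = tensor_vector_field[OF A X] and AY = tensor_vector_field[OF A Y]
  have D_T: "D V W p \<in> tangent_space \<A> p" if "V \<in> vector_fields \<A>" "W \<in> vector_fields \<A>" for V W
    using D that by (simp add: symmetric_connection_def linear_connection_def vector_field_tangent)
  have br: "lie_bracket V W p = D V W p - D W V p"
    if "V \<in> vector_fields \<A>" "W \<in> vector_fields \<A>" for V W
  proof -
    have "D V W - D W V - lie_bracket V W = 0"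
      using D that by (simp add: symmetric_connection_def)
    then have "lie_bracket V W = D V W - D W V" by simp
    then show ?thesis by simp
  qed
  note T = D_T[OF X Y] D_T[OF Y X] D_T[OF AX Y] D_T[OF Y AX] D_T[OF X AY] D_T[OF AY X]
  have AA: "A p (A p (D X Y p - D Y X p)) = A p (A p (D X Y p)) - A p (A p (D Y X p))"
    unfolding tensor_diff[OF A T(1,2)]
    by (rule tensor_diff[OF A]) (rule tensor_tangent[OF A], rule T)+
  show "nijenhuis A X Y p = (cov_deriv D (A \<cdot> X) A Y - cov_deriv D (A \<cdot> Y) A X
      - A \<cdot> cov_deriv D X A Y + A \<cdot> cov_deriv D Y A X) p"
    unfolding nijenhuis_def cov_deriv_def plus_fun_apply minus_apply tapply_at
      br[OF X Y] br[OF AX Y] br[OF X AY] br[OF AX AY] AA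
      tensor_diff[OF A T(3,4)] tensor_diff[OF A T(5,6)]
      tensor_diff[OF A T(5) tensor_tangent[OF A T(1)]] tensor_diff[OF A T(4) tensor_tangent[OF A T(2)]]
    by (simp add: fun_eq_iff)
qed

lemma parallel_imp_integrable:
  assumes A: "tensor_field11 \<A> A" and D: "symmetric_connection \<A> D" and par: "parallel_tensor \<A> D A"
  shows "integrable_tensor \<A> A"
  unfolding integrable_tensor_def
proof (intro ballI)
  fix X Y assume X: "X \<in> vector_fields \<A>" and Y: "Y \<in> vector_fields \<A>"
  have A0: "A \<cdot> 0 = 0" 
  proof
    fix p
    have "0 \<in> tangent_space \<A> p" by (simp add: tangent_space_def)
    then show "(A \<cdot> 0) p = 0 p"
      using tensor_diff[OF A, of 0 p 0] by (simp add: tapply_def)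
  qed
  have "cov_deriv D V A W = 0" if "V \<in> vector_fields \<A>" "W \<in> vector_fields \<A>" for V W
    using par that by (simp add: parallel_tensor_def)
  then show "nijenhuis A X Y = 0"
    unfolding nijenhuis_cov_deriv[OF A D X Y]
    using X Y tensor_vector_field[OF A X] tensor_vector_field[OF A Y] by (simp add: A0)
qed

text \<open>In the Leibniz rule of the connection the derivative of a constant vanishes.\<close>

lemma connection_const_scale:
  assumes D: "linear_connection \<A> D" and X: "X \<in> vector_fields \<A>" and Y: "Y \<in> vector_fields \<A>"
  shows "D X ((\<lambda>q. c) *\<^sub>F Y) = (\<lambda>q. c) *\<^sub>F D X Y"
proof -
  have "D X ((\<lambda>q. c) *\<^sub>F Y) = vderiv X (\<lambda>q. c) *\<^sub>F Y + (\<lambda>q. c) *\<^sub>F D X Y"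
    using D X Y smooth_functions_const[of c \<A>] unfolding linear_connection_def by blast
  moreover have "vderiv X (\<lambda>q. c) = (\<lambda>q. 0)"
    by (simp add: vderiv_def tangent_const[OF vector_field_tangent[OF X]])
  ultimately show ?thesis
    by (simp add: fscale_def tscale_def plus_fun_def)
qed

lemma parallel_affine:
  assumes \<A>: "smooth_atlas \<A>" and A: "tensor_field11 \<A> A" and D: "linear_connection \<A> D"
    and par: "parallel_tensor \<A> D A"
  shows "parallel_tensor \<A> D (tensor_affine c d A)"
  unfolding parallel_tensor_def
proof (intro ballI)
  fix X Y assume X: "X \<in> vector_fields \<A>" and Y: "Y \<in> vector_fields \<A>"
  note AY = tensor_vector_field[OF A Y]
  have scale: "(\<lambda>q. e) *\<^sub>F Z \<in> vector_fields \<A>" if "Z \<in> vector_fields \<A>" for e Z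
    using vector_fields_lincomb[OF \<A> that that, of e 0] by (simp add: fscale_def tscale_def plus_fun_def)
  have "tensor_affine c d A \<cdot> Y = (\<lambda>q. c) *\<^sub>F (A \<cdot> Y) + (\<lambda>q. d) *\<^sub>F Y"
    by (simp add: tensor_affine_apply fscale_def fun_eq_iff)
  then have "D X (tensor_affine c d A \<cdot> Y) = (\<lambda>q. c) *\<^sub>F D X (A \<cdot> Y) + (\<lambda>q. d) *\<^sub>F D X Y"
    using D X scale[OF AY] scale[OF Y] connection_const_scale[OF D X AY] connection_const_scale[OF D X Y]
    by (simp add: linear_connection_def)
  moreover have "D X (A \<cdot> Y) = A \<cdot> D X Y"
    using par X Y by (simp add: parallel_tensor_def cov_deriv_def)
  ultimately show "cov_deriv D X (tensor_affine c d A) Y = 0"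
    by (simp add: cov_deriv_def tensor_affine_apply fscale_def fun_eq_iff)
qed

section \<open>Metallic structures\<close>

lemma metallic_mean_gap: "b > 0 \<Longrightarrow> 2 * metallic_mean a b - real a > 0"
  by (simp add: metallic_mean_def add_nonneg_pos)

text \<open>The product of the two eigenvalues \<open>\<rho>\<close> and \<open>a - \<rho>\<close> is therefore \<open>- b\<close>, and their sum is \<open>a\<close>.\<close>

lemma metallic_mean_root: "metallic_mean a b ^ 2 = real a * metallic_mean a b + real b"
proof -
  have "sqrt (real a ^ 2 + 4 * real b) ^ 2 = real a ^ 2 + 4 * real b"
    by simp
  then show ?thesis
    unfolding metallic_mean_def by (simp add: power2_eq_square field_simps)
qed

lemma proj_l_affine: "proj_l a b J = tensor_affine (1 / (2 * metallic_mean a b - real a))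
    (- ((real a - metallic_mean a b) / (2 * metallic_mean a b - real a))) J"
  by (simp add: proj_l_def tensor_affine_def tscale_def fun_eq_iff)

lemma proj_m_affine: "proj_m a b J = tensor_affine (- 1 / (2 * metallic_mean a b - real a))
    (metallic_mean a b / (2 * metallic_mean a b - real a)) J"
  by (simp add: proj_m_def tensor_affine_def)

lemma assoc_F_affine: "assoc_F a b J = tensor_affine (2 / (2 * metallic_mean a b - real a))
    (- (real a / (2 * metallic_mean a b - real a))) J"
  by (simp add: assoc_F_def tensor_affine_def tscale_def fun_eq_iff)

lemma metallic_from_assoc_F:
  assumes "b > 0"
  shows "J = tensor_affine ((2 * metallic_mean a b - real a) / 2) (real a / 2) (assoc_F a b J)"
proof -
  define s where "s = 2 * metallic_mean a b - real a"
  have "s \<noteq> 0"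
    using metallic_mean_gap[OF assms, of a] by (simp add: s_def)
  then have "s / 2 * (2 / s * x + - (real a / s) * y) + real a / 2 * y = x" for x y
    by (simp add: field_simps)
  then show ?thesis
    unfolding assoc_F_affine s_def[symmetric] by (simp add: tensor_affine_def tscale_def fun_eq_iff)
qed

text \<open>The hypothesis on \<open>A\<close> is \<open>(A - \<kappa> I)(A - \<mu> I) = 0\<close>, so the image of every multiple of
  \<open>A - \<mu> I\<close> lies in the eigenspace for \<open>\<kappa>\<close>.\<close>

lemma affine_section_eigendistribution:
  assumes \<A>: "smooth_atlas \<A>" and A: "tensor_field11 \<A> A"
    and quad: "\<forall>p. \<forall>v\<in>tangent_space \<A> p. A p (A p v) = (\<kappa> + \<mu>) *\<^sub>T A p v + (- \<kappa> * \<mu>) *\<^sub>T v"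
    and X: "X \<in> vector_fields \<A>"
  shows "tensor_affine c (- c * \<mu>) A \<cdot> X \<in> sections \<A> (eigendistribution \<A> A \<kappa>)"
proof -
  have V: "tensor_affine c (- c * \<mu>) A \<cdot> X \<in> vector_fields \<A>"
    by (rule tensor_vector_field[OF tensor_field11_affine[OF \<A> A] X])
  note T = vector_field_tangent[OF X]
  have "A p (c *\<^sub>T A p (X p) + (- c * \<mu>) *\<^sub>T X p) = \<kappa> *\<^sub>T (c *\<^sub>T A p (X p) + (- c * \<mu>) *\<^sub>T X p)" for p
    unfolding tensor_lincomb[OF A tensor_tangent[OF A T] T] quad[rule_format, OF T]
    by (simp add: tscale_def fun_eq_iff algebra_simps)
  then show ?thesis
    using V vector_field_tangent[OF V]
    by (simp add: sections_def eigendistribution_def tensor_affine_apply tapply_at)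
qed

theorem corollary1:
  fixes \<A> :: "('a::{t2_space, second_countable_topology}, 'n::finite) chart set"
    and g :: "'a tensor02" and J :: "'a tensor11" and a b :: nat
  assumes "a > 0" and "b > 0"
    and "metallic_riemannian a b \<A> g J"
  defines "l \<equiv> proj_l a b J" and "m \<equiv> proj_m a b J" and "F \<equiv> assoc_F a b J"
    and "L \<equiv> dist_L a b \<A> J" and "M \<equiv> dist_M a b \<A> J"
  shows
    "(\<forall>X\<in>vector_fields \<A>. \<forall>Y\<in>vector_fields \<A>.
        gfun g (l \<cdot> X) Y = gfun g X (l \<cdot> Y) \<and> gfun g (m \<cdot> X) Y = gfun g X (m \<cdot> Y)) \<and>
     (orthogonal_distributions \<A> g L M \<and>
      (\<forall>X\<in>vector_fields \<A>. \<forall>Y\<in>vector_fields \<A>. gfun g (l \<cdot> X) (m \<cdot> Y) = 0)) \<and>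
     (\<forall>X\<in>vector_fields \<A>. \<forall>Y\<in>vector_fields \<A>.
        nijenhuis J (J \<cdot> X) Y = nijenhuis J X (J \<cdot> Y)) \<and>
     (\<forall>D. symmetric_connection \<A> D \<longrightarrow>
        (\<forall>X\<in>vector_fields \<A>. \<forall>Y\<in>vector_fields \<A>.
           nijenhuis F X Y =
             cov_deriv D (F \<cdot> X) F Y - cov_deriv D (F \<cdot> Y) F X
             - F \<cdot> cov_deriv D X F Y + F \<cdot> cov_deriv D Y F X)) \<and>
     (locally_product_metallic a b \<A> g J \<longrightarrow> integrable_tensor \<A> J)"
proof -
  define r where "r = metallic_mean a b"
  define s where "s = 2 * r - real a"
  have \<A>: "smooth_atlas \<A>" and g: "riemannian_metric \<A> g" and J: "tensor_field11 \<A> J"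
    and sym: "g_symmetric \<A> g J"
    and JJ: "\<forall>p. \<forall>v\<in>tangent_space \<A> p. J p (J p v) = real a *\<^sub>T J p v + real b *\<^sub>T v"
    using assms(3) by (auto simp: metallic_riemannian_def metallic_structure_def)
  have s: "s > 0"
    using metallic_mean_gap[OF assms(2)] by (simp add: s_def r_def)
  have l: "l = tensor_affine (1 / s) (- (1 / s) * (real a - r)) J"
    and m: "m = tensor_affine (- 1 / s) (- (- 1 / s) * r) J"
    and F: "F = tensor_affine (2 / s) (- (real a / s)) J"
    by (simp_all add: l_def m_def F_def proj_l_affine proj_m_affine assoc_F_affine s_def r_def)
  \<comment> \<open>The coefficients of the quadratic equation of \<open>J\<close> in terms of its roots \<open>r\<close> and \<open>a - r\<close>,
    which makes \<open>l\<close> and \<open>m\<close> multiples of \<open>J - (a - r) I\<close> and \<open>J - r I\<close>.\<close>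
  have b: "real b = - r * (real a - r)"
    using metallic_mean_root[of a b] by (simp add: r_def power2_eq_square algebra_simps)
  have sym_lm: "g_symmetric \<A> g l" "g_symmetric \<A> g m"
    unfolding l m by (rule g_symmetric_affine[OF g J sym])+
  have LM: "orthogonal_distributions \<A> g L M"
    unfolding L_def M_def dist_L_def dist_M_def
    using s by (intro eigendistributions_orthogonal[OF g sym]) (simp add: s_def r_def)
  have lX: "l \<cdot> X \<in> sections \<A> L" if "X \<in> vector_fields \<A>" for X
    unfolding l L_def dist_L_def r_def[symmetric]
    by (rule affine_section_eigendistribution[OF \<A> J _ that]) (simp add: JJ b)
  have mY: "m \<cdot> Y \<in> sections \<A> M" if "Y \<in> vector_fields \<A>" for Y
    unfolding m M_def dist_M_def r_def[symmetric]
    by (rule affine_section_eigendistribution[OF \<A> J _ that]) (simp add: JJ b algebra_simps)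
  have F_tensor: "tensor_field11 \<A> F"
    unfolding F by (rule tensor_field11_affine[OF \<A> J])
  have integrable: "integrable_tensor \<A> J" if lp: "locally_product_metallic a b \<A> g J"
  proof -
    obtain D where D: "symmetric_connection \<A> D" and par: "parallel_tensor \<A> D F"
      using lp by (auto simp: locally_product_metallic_def locally_product_structure_def
          levi_civita_connection_def F_def)
    have "linear_connection \<A> D"
      using D by (simp add: symmetric_connection_def)
    then have "parallel_tensor \<A> D J"
      using parallel_affine[OF \<A> F_tensor _ par] metallic_from_assoc_F[OF assms(2), of J a]
      by (metis F_def)
    then show ?thesis
      by (rule parallel_imp_integrable[OF J D])
  qed
  show ?thesis
    using sym_lm LM lX mY nijenhuis_quadratic_symmetric[OF \<A> J JJ] nijenhuis_cov_deriv[OF F_tensor] integrable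
    unfolding g_symmetric_def orthogonal_distributions_def by blast
qed

end
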